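(* Let $m,n,k,p$ be nonnegative integers with $0\le p\le m$ and $n>0$. Then $$\binom{m+1,\,n-1}{k}=\sum_{i=0}^{p}(-1)^i\binom{p}{i}\binom{m-p+1,\,n+p-1-i}{k}.$$
   Context: For nonnegative integers $m,n,k$, let $X$ be a set that is the disjoint union of blocks $X_1,\dots,X_n,Y$ with $|X_i|=2$ for $i=1,\dots,n$ and $|Y|=m$. The number $\binom{m,n}{k}$ (two entries on top) is defined as the number of $(n+k)$-element subsets of $X$ that intersect each block $X_i$, $i=1,\dots,n$ (such subsets are called $(n+k)$-insets of $X$). The symbol $\binom{p}{i}$ (one entry on top) is the ordinary binomial coefficient. *)

theory Defs
  imports Complex_Main "HOL-Library.Disjoint_Sets"
begin

definition block_decomposition ::
  "nat \<Rightarrow> nat \<Rightarrow> 'a set \<Rightarrow> (nat \<Rightarrow> 'a set) \<Rightarrow> 'a set \<Rightarrow> bool"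
where
  "block_decomposition m n X B Y \<longleftrightarrow>
     X = (\<Union>i\<in>{1..n}. B i) \<union> Y \<and>
     disjoint_family_on B {1..n} \<and>
     (\<forall>i\<in>{1..n}. B i \<inter> Y = {} \<and> card (B i) = 2) \<and>
     finite Y \<and> card Y = m"

definition insets :: "nat \<Rightarrow> nat \<Rightarrow> 'a set \<Rightarrow> (nat \<Rightarrow> 'a set) \<Rightarrow> 'a set set" where
  "insets n k X B = {S. S \<subseteq> X \<and> card S = n + k \<and> (\<forall>i\<in>{1..n}. S \<inter> B i \<noteq> {})}"

(* The counting function is defined on one concrete decomposition, X = {1..2n+m} with
   X_i = {2i-1, 2i} and Y = {2n+1..2n+m}; card_insets_eq below shows that every other
   decomposition with the same m and n gives the same number. *)
definition std_block :: "nat \<Rightarrow> nat set" where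
  "std_block i = {2 * i - 1, 2 * i}"

definition inset_binomial :: "nat \<Rightarrow> nat \<Rightarrow> nat \<Rightarrow> nat" where
  "inset_binomial m n k = card (insets n k {1..2 * n + m} std_block)"

lemma block_decomposition_std:
  "block_decomposition m n {1..2 * n + m} std_block {2 * n + 1..2 * n + m}"
proof -
  have "{1..2 * n + m} \<subseteq> (\<Union>i\<in>{1..n}. std_block i) \<union> {2 * n + 1..2 * n + m}"
  proof
    fix x assume x: "x \<in> {1..2 * n + m}"
    show "x \<in> (\<Union>i\<in>{1..n}. std_block i) \<union> {2 * n + 1..2 * n + m}"
    proof (cases "x \<le> 2 * n")
      case True
      have "(x + 1) div 2 \<in> {1..n}" using True x by auto
      moreover have "x \<in> std_block ((x + 1) div 2)"
        unfolding std_block_def using x by simp presburger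
      ultimately show ?thesis by blast
    qed (use x in auto)
  qed
  moreover have "(\<Union>i\<in>{1..n}. std_block i) \<union> {2 * n + 1..2 * n + m} \<subseteq> {1..2 * n + m}"
    by (auto simp: std_block_def)
  moreover have "disjoint_family_on std_block {1..n}"
    unfolding disjoint_family_on_def std_block_def by auto
  moreover have "std_block i \<inter> {2 * n + 1..2 * n + m} = {} \<and> card (std_block i) = 2"
    if "i \<in> {1..n}" for i
    using that by (auto simp: std_block_def card_insert_if)
  ultimately show ?thesis
    unfolding block_decomposition_def by auto
qed

lemma block_decomposition_bij:
  assumes "block_decomposition m n X B Y" "block_decomposition m n X' B' Y'"
  shows "\<exists>f. bij_betw f X X' \<and> (\<forall>i\<in>{1..n}. f ` B i = B' i)"
  using assms
proof (induction n arbitrary: X X')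
  case 0
  then show ?case
    by (auto simp: block_decomposition_def intro: finite_same_card_bij)
next
  case (Suc n)
  define Z Z' where "Z = (\<Union>i\<in>{1..n}. B i) \<union> Y" and "Z' = (\<Union>i\<in>{1..n}. B' i) \<union> Y'"
  have dec: "block_decomposition m n Z B Y" "block_decomposition m n Z' B' Y'"
    using Suc.prems by (auto simp: block_decomposition_def Z_def Z'_def disjoint_family_on_def)
  obtain f where f: "bij_betw f Z Z'" "\<forall>i\<in>{1..n}. f ` B i = B' i"
    using Suc.IH[OF dec] by blast
  have card2: "card (B (Suc n)) = 2" "card (B' (Suc n)) = 2"
    using Suc.prems by (auto simp: block_decomposition_def)
  then have "finite (B (Suc n))" "finite (B' (Suc n))"
    by (auto intro: card_ge_0_finite)
  then obtain g where g: "bij_betw g (B (Suc n)) (B' (Suc n))"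
    using finite_same_card_bij card2 by metis
  have I: "{1..Suc n} = insert (Suc n) {1..n}" by auto
  have "disjoint_family_on B {1..Suc n}" "disjoint_family_on B' {1..Suc n}"
    using Suc.prems by (simp_all add: block_decomposition_def)
  then have "(\<Union>i\<in>{1..n}. B i) \<inter> B (Suc n) = {}" "(\<Union>i\<in>{1..n}. B' i) \<inter> B' (Suc n) = {}"
    unfolding I by (simp_all add: disjoint_family_on_insert Int_commute)
  moreover have "Y \<inter> B (Suc n) = {}" "Y' \<inter> B' (Suc n) = {}"
    using Suc.prems by (simp_all add: block_decomposition_def Int_commute)
  ultimately have disj: "Z \<inter> B (Suc n) = {}" "Z' \<inter> B' (Suc n) = {}"
    by (simp_all add: Z_def Z'_def Int_Un_distrib2)
  have "X = (\<Union>i\<in>{1..Suc n}. B i) \<union> Y" "X' = (\<Union>i\<in>{1..Suc n}. B' i) \<union> Y'"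
    using Suc.prems by (simp_all add: block_decomposition_def)
  then have X: "X = Z \<union> B (Suc n)" "X' = Z' \<union> B' (Suc n)"
    unfolding I Z_def Z'_def by blast+
  define h where "h = (\<lambda>x. if x \<in> Z then f x else g x)"
  have "bij_betw h X X'"
    unfolding h_def X by (rule bij_betw_disjoint_Un[OF f(1) g disj])
  moreover have "h ` B i = B' i" if "i \<in> {1..Suc n}" for i
  proof (cases "i = Suc n")
    case True
    have "h ` B (Suc n) = g ` B (Suc n)"
      using disj by (intro image_cong) (auto simp: h_def)
    then show ?thesis using True g by (simp add: bij_betw_def)
  next
    case False
    then have i: "i \<in> {1..n}" using that by auto
    then have "h ` B i = f ` B i"
      by (intro image_cong) (auto simp: h_def Z_def)
    then show ?thesis using f(2) i by simp
  qed
  ultimately show ?case by blast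
qed

lemma card_insets_cong:
  assumes "block_decomposition m n X B Y" "block_decomposition m n X' B' Y'"
  shows "card (insets n k X B) = card (insets n k X' B')"
proof -
  obtain f where f: "bij_betw f X X'" and fB: "\<forall>i\<in>{1..n}. f ` B i = B' i"
    using block_decomposition_bij[OF assms] by blast
  have sub: "B i \<subseteq> X" if "i \<in> {1..n}" for i
    using assms(1) that by (auto simp: block_decomposition_def)
  have inj: "inj_on f X" and im: "f ` X = X'"
    using f by (auto simp: bij_betw_def)
  have iff: "f ` S \<in> insets n k X' B' \<longleftrightarrow> S \<in> insets n k X B" if "S \<subseteq> X" for S
  proof -
    have "card (f ` S) = card S"
      using inj that by (meson card_image inj_on_subset)
    moreover have "f ` S \<inter> B' i = f ` (S \<inter> B i)" if "i \<in> {1..n}" for i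
      using fB inj_on_image_Int[OF inj \<open>S \<subseteq> X\<close> sub[OF that]] that by simp
    moreover have "f ` S \<subseteq> X'" using that im by auto
    ultimately show ?thesis using that by (auto simp: insets_def)
  qed
  have Sub: "S \<subseteq> X" if "S \<in> insets n k X B" for S
    using that by (simp add: insets_def)
  have "bij_betw ((`) f) (insets n k X B) (insets n k X' B')"
  proof (rule bij_betw_imageI)
    show "inj_on ((`) f) (insets n k X B)"
      by (rule inj_on_subset[OF inj_on_image_Pow[OF inj]]) (auto simp: insets_def)
    show "(`) f ` insets n k X B = insets n k X' B'"
    proof
      show "(`) f ` insets n k X B \<subseteq> insets n k X' B'"
        using iff Sub by blast
      show "insets n k X' B' \<subseteq> (`) f ` insets n k X B"
      proof
        fix T assume T: "T \<in> insets n k X' B'"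
        then have "T \<subseteq> f ` X" using im by (auto simp: insets_def)
        then obtain S where "S \<subseteq> X" "T = f ` S"
          by (meson subset_imageE)
        then show "T \<in> (`) f ` insets n k X B" using iff T by blast
      qed
    qed
  qed
  then show ?thesis by (rule bij_betw_same_card)
qed

theorem card_insets_eq:
  assumes "block_decomposition m n X B Y"
  shows "card (insets n k X B) = inset_binomial m n k"
  unfolding inset_binomial_def
  by (rule card_insets_cong[OF assms block_decomposition_std])

end

theory Submission
  imports Defs
begin

text \<open>
  A free element contributes \<open>1 + x\<close> to the generating function of insets by size, and a block,
  which has to be met, contributes \<open>2 * x + x\<^sup>2\<close>. So the number of \<open>(n + k)\<close>-insets is the
  coefficient of \<open>x\<^sup>k\<close> in \<open>(1 + x)\<^sup>m * (2 + x)\<^sup>n\<close>. Writing \<open>p\<close> of the factors \<open>1 + x\<close> as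
  \<open>(2 + x) - 1\<close> and expanding \<open>((2 + x) - 1)\<^sup>p\<close> by the binomial theorem gives the alternating sum.

  Instead of polynomials, the proof uses the combinatorial form of \<open>2 + x = (1 + x) + 1\<close>, lemma
  \<open>inset_binomial_Suc_blocks\<close>: an inset either contains a chosen element \<open>a\<close> of a chosen
  block \<open>{a, b}\<close>, after which \<open>b\<close> behaves like a free element of \<open>Y\<close>, or it avoids \<open>a\<close>, after
  which it is forced to contain \<open>b\<close>. Lemma \<open>iterated_difference\<close> does the expansion for any
  function of two arguments with this recurrence.
\<close>

lemma block_decomposition_remove_block:
  assumes dec: "block_decomposition m (Suc n) X B Y" and Bab: "B (Suc n) = {a, b}"
  shows "block_decomposition m n (X - {a, b}) B Y"
    and "block_decomposition (Suc m) n (X - {a}) B (insert b Y)"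
    and "a \<in> X" "b \<in> X" "a \<noteq> b" "\<And>i. i \<in> {1..n} \<Longrightarrow> a \<notin> B i \<and> b \<notin> B i"
proof -
  have I: "{1..Suc n} = insert (Suc n) {1..n}" by auto
  have X: "X = (\<Union>i\<in>{1..n}. B i) \<union> {a, b} \<union> Y"
    using dec Bab unfolding block_decomposition_def I by auto
  have disj: "disjoint_family_on B {1..n}" and away: "{a, b} \<inter> (\<Union>i\<in>{1..n}. B i) = {}"
    using dec Bab unfolding block_decomposition_def I
    by (auto simp: disjoint_family_on_insert)
  have Y: "a \<notin> Y" "b \<notin> Y" "finite Y" "card Y = m"
    and blocks: "\<And>i. i \<in> {1..n} \<Longrightarrow> B i \<inter> Y = {} \<and> card (B i) = 2"
    and two: "card {a, b} = 2"
    using dec Bab unfolding block_decomposition_def I by auto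
  show "a \<noteq> b" using two by auto
  show notin: "a \<notin> B i \<and> b \<notin> B i" if "i \<in> {1..n}" for i
    using away that by auto
  show "a \<in> X" "b \<in> X" using X by auto
  have "X - {a, b} = (\<Union>i\<in>{1..n}. B i) \<union> Y"
    using X away Y by blast
  then show "block_decomposition m n (X - {a, b}) B Y"
    unfolding block_decomposition_def using disj blocks Y by blast
  have "X - {a} = (\<Union>i\<in>{1..n}. B i) \<union> insert b Y"
    using X away Y \<open>a \<noteq> b\<close> by blast
  moreover have "\<forall>i\<in>{1..n}. B i \<inter> insert b Y = {} \<and> card (B i) = 2"
    using blocks notin by blast
  moreover have "finite (insert b Y)" "card (insert b Y) = Suc m"
    using Y by auto
  ultimately show "block_decomposition (Suc m) n (X - {a}) B (insert b Y)"
    unfolding block_decomposition_def using disj by blast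
qed

text \<open>
  Adding an element \<open>c\<close> of the last block to an inset for the first \<open>n\<close> blocks raises the size and
  the number of blocks met by one each, so the excess \<open>k\<close> is unchanged.
\<close>

lemma insets_add_element:
  assumes "finite Z" "c \<notin> Z" "c \<in> B (Suc n)" "\<And>i. i \<in> {1..n} \<Longrightarrow> c \<notin> B i"
  shows "insert c ` insets n k Z B = {S \<in> insets (Suc n) k (insert c Z) B. c \<in> S}"
proof (intro equalityI subsetI)
  fix S assume "S \<in> insert c ` insets n k Z B"
  then obtain T where T: "T \<in> insets n k Z B" "S = insert c T" by blast
  then have TZ: "T \<subseteq> Z" "card T = n + k" by (auto simp: insets_def)
  then have "finite T" "c \<notin> T" using assms finite_subset by auto
  then have "card S = Suc n + k" using T TZ by simp
  moreover have "S \<inter> B i \<noteq> {}" if "i \<in> {1..Suc n}" for i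
  proof (cases "i = Suc n")
    case True
    then show ?thesis using assms(3) T(2) by auto
  next
    case False
    then have "i \<in> {1..n}" using that by auto
    then show ?thesis using T by (auto simp: insets_def)
  qed
  ultimately show "S \<in> {S \<in> insets (Suc n) k (insert c Z) B. c \<in> S}"
    using T(2) TZ by (auto simp: insets_def)
next
  fix S assume "S \<in> {S \<in> insets (Suc n) k (insert c Z) B. c \<in> S}"
  then have S: "S \<subseteq> insert c Z" "card S = Suc n + k" "c \<in> S"
    "\<And>i. i \<in> {1..Suc n} \<Longrightarrow> S \<inter> B i \<noteq> {}"
    by (auto simp: insets_def)
  have "S - {c} \<in> insets n k Z B"
  proof -
    have "finite S" using S(1) assms(1) finite_subset by blast
    then have "card (S - {c}) = n + k" using S by simp
    moreover have "(S - {c}) \<inter> B i \<noteq> {}" if "i \<in> {1..n}" for i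
    proof -
      have "S \<inter> B i \<noteq> {}" using S(4) that by simp
      then show ?thesis using assms(4)[OF that] by blast
    qed
    ultimately show ?thesis using S(1) by (auto simp: insets_def)
  qed
  moreover have "S = insert c (S - {c})" using S(3) by auto
  ultimately show "S \<in> insert c ` insets n k Z B" by blast
qed

lemma card_insets_add_element:
  assumes "c \<notin> Z"
  shows "card (insert c ` insets n k Z B) = card (insets n k Z B)"
proof (rule card_image)
  show "inj_on (insert c) (insets n k Z B)"
    using assms by (intro inj_onI) (auto simp: insets_def insert_ident subset_iff)
qed

text \<open>
  The first summand counts the insets containing one chosen element of the new block, whose other
  element is then free; the second counts those that avoid it and so contain the other element.
\<close>

lemma inset_binomial_Suc_blocks:
  "inset_binomial m (Suc n) k = inset_binomial (Suc m) n k + inset_binomial m n k"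
proof -
  let ?X = "{1..2 * Suc n + m}" and ?B = std_block
  define a b :: nat where "a = 2 * n + 1" and "b = 2 * n + 2"
  have Bab: "?B (Suc n) = {a, b}" by (simp add: std_block_def a_def b_def)
  note dec = block_decomposition_std[of m "Suc n"]
  note rem = block_decomposition_remove_block[OF dec Bab]
  have fin: "finite ?X" by simp
  let ?I = "insets (Suc n) k ?X ?B"
  have "{S \<in> ?I. a \<in> S} = insert a ` insets n k (?X - {a}) ?B"
    using insets_add_element[of "?X - {a}" a ?B n k] Bab rem(3,6) by (simp add: insert_absorb)
  then have with_a: "card {S \<in> ?I. a \<in> S} = inset_binomial (Suc m) n k"
    using card_insets_add_element[of a "?X - {a}"] card_insets_eq[OF rem(2)] by simp
  \<comment> \<open>An inset avoiding \<open>a\<close> must meet the block \<open>{a, b}\<close> in \<open>b\<close>.\<close>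
  have "{S \<in> ?I. a \<notin> S} = {S \<in> insets (Suc n) k (?X - {a}) ?B. b \<in> S}"
  proof -
    have "b \<in> S" if "S \<in> ?I" "a \<notin> S" for S
    proof -
      have "S \<inter> ?B (Suc n) \<noteq> {}" using that(1) by (simp add: insets_def)
      then show ?thesis using that(2) Bab by auto
    qed
    then show ?thesis by (auto simp: insets_def)
  qed
  also have "?X - {a} = insert b (?X - {a, b})"
    using rem(4,5) by auto
  also have "{S \<in> insets (Suc n) k (insert b (?X - {a, b})) ?B. b \<in> S}
      = insert b ` insets n k (?X - {a, b}) ?B"
    using insets_add_element[of "?X - {a, b}" b ?B n k] Bab rem(6) by simp
  finally have without_a: "card {S \<in> ?I. a \<notin> S} = inset_binomial m n k"
    using card_insets_add_element[of b "?X - {a, b}"] card_insets_eq[OF rem(1)] by simp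
  have "?I \<subseteq> Pow ?X" by (auto simp: insets_def)
  then have "finite ?I" using fin by (meson finite_Pow_iff finite_subset)
  then have "card ({S \<in> ?I. a \<in> S} \<union> {S \<in> ?I. a \<notin> S})
      = card {S \<in> ?I. a \<in> S} + card {S \<in> ?I. a \<notin> S}"
    by (intro card_Un_disjoint) auto
  moreover have "{S \<in> ?I. a \<in> S} \<union> {S \<in> ?I. a \<notin> S} = ?I" by blast
  ultimately show ?thesis
    using with_a without_a by (simp only: inset_binomial_def[of m "Suc n"])
qed

text \<open>
  The recurrence says that raising the first argument applies the forward difference in the second
  one, so raising it \<open>p\<close> times applies \<open>p\<close> differences; the signed binomials arise by Pascal's rule.
\<close>

lemma iterated_difference:
  fixes g :: "nat \<Rightarrow> nat \<Rightarrow> 'a::comm_ring_1"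
  assumes rec: "\<And>m n. g (Suc m) n = g m (Suc n) - g m n"
  shows "g (m + p) n = (\<Sum>i\<le>p. (-1) ^ i * of_nat (p choose i) * g m (n + p - i))"
proof (induction p arbitrary: n)
  case 0
  then show ?case by simp
next
  case (Suc p)
  let ?t = "\<lambda>c i. (-1) ^ i * of_nat c * g m (n + Suc p - i)"
  have "g (m + Suc p) n = (\<Sum>i\<le>p. ?t (p choose i) i)
      - (\<Sum>i\<le>p. (-1) ^ i * of_nat (p choose i) * g m (n + p - i))"
    using rec[of "m + p" n] Suc.IH[of "Suc n"] Suc.IH[of n] by simp
  \<comment> \<open>The index \<open>Suc p\<close> can be included because \<open>p choose Suc p\<close> is zero.\<close>
  also have "(\<Sum>i\<le>p. ?t (p choose i) i) = (\<Sum>i\<le>Suc p. ?t (p choose i) i)"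
    by (simp add: binomial_eq_0)
  also have "\<dots> = ?t 1 0 + (\<Sum>i\<le>p. ?t (p choose Suc i) (Suc i))"
    by (subst sum.atMost_Suc_shift) simp
  also have "\<dots> - (\<Sum>i\<le>p. (-1) ^ i * of_nat (p choose i) * g m (n + p - i))
      = ?t 1 0 + (\<Sum>i\<le>p. ?t (Suc p choose Suc i) (Suc i))"
    by (simp add: algebra_simps sum.distrib sum_negf sum_subtractf)
  also have "\<dots> = (\<Sum>i\<le>Suc p. ?t (Suc p choose i) i)"
    by (subst sum.atMost_Suc_shift) simp
  finally show ?case .
qed

theorem proposition1:
  fixes m n k p :: nat
  assumes "p \<le> m" and "n > 0"
  shows "int (inset_binomial (m + 1) (n - 1) k) =
    (\<Sum>i=0..p. (-1) ^ i * int (p choose i) * int (inset_binomial (m - p + 1) (n + p - 1 - i) k))"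
proof -
  have "int (inset_binomial (m - p + 1 + p) (n - 1) k) =
    (\<Sum>i\<le>p. (-1) ^ i * int (p choose i) * int (inset_binomial (m - p + 1) (n - 1 + p - i) k))"
    using iterated_difference[of "\<lambda>m n. int (inset_binomial m n k)" "m - p + 1" p "n - 1"]
    by (simp add: inset_binomial_Suc_blocks)
  moreover have "m - p + 1 + p = m + 1" "n - 1 + p = n + p - 1"
    using assms by auto
  ultimately show ?thesis by (simp add: atMost_atLeast0)
qed

end
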